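(* Let $d\ge 0$ be an integer and let $\mathcal C_1,\dots,\mathcal C_{d+1}$ be finite nonempty families of convex sets in $\mathbb R^d$. If $C_1\cap\cdots\cap C_{d+1}\neq\varnothing$ for every choice of $C_i\in\mathcal C_i$ ($i=1,\dots,d+1$), then $$\sum_{i=1}^{d+1}\dim\Bigl(\bigcap\mathcal C_i\Bigr)\ \ge\ 0 .$$
   Context: For a family $\mathcal C_i$ of sets, $\bigcap\mathcal C_i$ is the intersection of all its members. The dimension of a nonempty convex set is the dimension of its affine hull, and by convention $\dim\varnothing=-1$. *)

theory Defs
  imports "HOL-Analysis.Analysis"
begin

end

theory Submission
  imports Defs
begin

text \<open>
  Replacing each set by the convex hull of chosen points of the rainbow intersections, we may
  assume that all sets are compact. Write \<open>K\<^sub>i\<close> for \<open>\<Inter>(C i)\<close> and induct on the dimension \<open>d\<close>.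
  If the dimensions of the \<open>K\<^sub>i\<close> had a negative sum, then the union of the \<open>K\<^sub>i\<close> would have dimension
  less than \<open>d\<close> and hence lie in a proper hyperplane \<open>H\<close>. Intersecting with \<open>H\<close> does not change
  the \<open>K\<^sub>i\<close>, and some index \<open>j\<close> can be dropped with the sum staying negative, so by induction a rainbow
  choice from the families other than \<open>C j\<close> has an intersection missing \<open>H\<close>, that is, lying strictly
  on one side of \<open>H\<close>. Lovasz's proof of the colorful Helly theorem, applied to the distance from a
  remote point on the other side, then yields a point of some \<open>K\<^sub>i\<close> off \<open>H\<close>, a contradiction.
\<close>

section \<open>Helly's theorem relative to a set\<close>

text \<open>Radon's argument: distinct points \<open>x j\<close>, each in all sets but perhaps
  \<open>F j\<close>, are too many to be affinely independent. A point common to both Radon hulls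
  lies in every \<open>F i\<close>, since one of the two sides avoids \<open>x i\<close>.\<close>

lemma Helly_aff_dim:
  fixes S :: "'a::euclidean_space set"
  assumes "finite I" and card: "aff_dim S + 2 \<le> int (card I)"
    and F: "\<And>i. i \<in> I \<Longrightarrow> convex (F i)"
    and meet: "\<And>j. j \<in> I \<Longrightarrow> S \<inter> (\<Inter>i\<in>I - {j}. F i) \<noteq> {}"
  shows "(\<Inter>i\<in>I. F i) \<noteq> {}"
proof -
  have "\<exists>x. \<forall>j\<in>I. x j \<in> S \<inter> (\<Inter>i\<in>I - {j}. F i)"
    using meet by (intro bchoice) blast
  then obtain x where x: "\<And>j. j \<in> I \<Longrightarrow> x j \<in> S"
      "\<And>i j. i \<in> I \<Longrightarrow> j \<in> I \<Longrightarrow> i \<noteq> j \<Longrightarrow> x j \<in> F i"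
    by blast
  show ?thesis
  proof (cases "inj_on x I")
    case False
    then obtain j k where jk: "j \<in> I" "k \<in> I" "j \<noteq> k" "x j = x k"
      unfolding inj_on_def by blast
    have "x j \<in> F i" if "i \<in> I" for i
      using x(2)[of i j] x(2)[of i k] jk that by metis
    then show ?thesis by blast
  next
    case True
    have "aff_dim (x ` I) \<le> aff_dim S"
      by (intro aff_dim_subset) (use x(1) in blast)
    then have "affine_dependent (x ` I)"
      using card card_image[OF True] aff_dim_affine_independent[of "x ` I"] by force
    then obtain M P where MP: "M \<subseteq> x ` I" "P \<subseteq> x ` I" "M \<inter> P = {}"
        "convex hull M \<inter> convex hull P \<noteq> {}"
      by (rule Radon)
    then obtain z where z: "z \<in> convex hull M" "z \<in> convex hull P" by blast
    have sub: "z \<in> F i" if "i \<in> I" "N \<subseteq> x ` I" "x i \<notin> N" "z \<in> convex hull N" for i N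
    proof -
      have "N \<subseteq> F i" using that x(2)[of i] by blast
      then show ?thesis using that F hull_minimal[of N "F i" convex] by blast
    qed
    have "z \<in> F i" if "i \<in> I" for i
      using sub[of i M] sub[of i P] z MP that by blast
    then show ?thesis by blast
  qed
qed

section \<open>Closest points and the colorful Helly theorem\<close>

text \<open>Join to the \<open>F i\<close> the open ball around \<open>a\<close> with
  \<open>q\<close> on its boundary. These at least \<open>aff_dim S + 2\<close> sets have no common
  point, so by Helly removing one of them still leaves no common point in \<open>S\<close>. The
  removed set is not the ball, since \<open>q\<close> lies in all \<open>F i\<close>.\<close>

lemma closest_point_Inter_facet:
  fixes S :: "'a::euclidean_space set"
  assumes I: "finite I" "aff_dim S + 1 \<le> int (card I)" "I \<noteq> {}" and S: "convex S"
    and F: "\<And>i. i \<in> I \<Longrightarrow> convex (F i) \<and> F i \<subseteq> S"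
    and q: "q \<in> (\<Inter>i\<in>I. F i)" and min: "\<And>x. x \<in> (\<Inter>i\<in>I. F i) \<Longrightarrow> dist a q \<le> dist a x"
  obtains j where "j \<in> I" "\<And>x. x \<in> S \<inter> (\<Inter>i\<in>I - {j}. F i) \<Longrightarrow> dist a q \<le> dist a x"
proof (rule ccontr)
  assume not: "\<not> thesis"
  note wit = that
  define G where "G k = (case k of None \<Rightarrow> ball a (dist a q) | Some i \<Rightarrow> F i)" for k
  let ?J = "insert None (Some ` I)"
  have "(\<Inter>k\<in>?J. G k) \<noteq> {}"
  proof (rule Helly_aff_dim)
    show "finite ?J" using I by simp
    show "aff_dim S + 2 \<le> int (card ?J)"
      using I by (simp add: card_image)
    show "convex (G k)" if "k \<in> ?J" for k
      using that F by (auto simp: G_def)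
    show "S \<inter> (\<Inter>k\<in>?J - {l}. G k) \<noteq> {}" if "l \<in> ?J" for l
    proof (cases l)
      case None
      have "q \<in> S" using q F I by blast
      moreover have "q \<in> G k" if "k \<in> ?J - {l}" for k
        using that None q by (auto simp: G_def)
      ultimately show ?thesis by blast
    next
      case (Some j)
      then have "j \<in> I" using that by auto
      then obtain x where x: "x \<in> S" "\<And>i. i \<in> I - {j} \<Longrightarrow> x \<in> F i" "dist a x < dist a q"
        using not wit[of j] by (metis (no_types, lifting) INT_iff IntE not_less)
      have "x \<in> G k" if "k \<in> ?J - {l}" for k
        using that Some x(2,3) by (cases k) (auto simp: G_def)
      then show ?thesis using x(1) by blast
    qed
  qed
  then obtain x where "x \<in> (\<Inter>i\<in>I. F i)" "dist a x < dist a q"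
    by (auto simp: G_def)
  then show False using min by force
qed

text \<open>
  Among all rainbow choices omitting one family, take one whose intersection is farthest from \<open>a\<close>;
  its closest point to \<open>a\<close> lies in every member of the omitted family.
\<close>

lemma colorful_Helly_dist:
  fixes S :: "'a::euclidean_space set" and C :: "'i \<Rightarrow> 'a set set"
  assumes I: "finite I" "aff_dim S + 1 \<le> int (card I)" and card: "2 \<le> card I" and S: "convex S"
    and fin: "\<And>i. i \<in> I \<Longrightarrow> finite (C i)" and ne: "\<And>i. i \<in> I \<Longrightarrow> C i \<noteq> {}"
    and C: "\<And>i K. i \<in> I \<Longrightarrow> K \<in> C i \<Longrightarrow> compact K \<and> convex K \<and> K \<subseteq> S"
    and meet: "\<And>R. (\<And>i. i \<in> I \<Longrightarrow> R i \<in> C i) \<Longrightarrow> (\<Inter>i\<in>I. R i) \<noteq> {}"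
    and j0: "j0 \<in> I" "\<And>i. i \<in> I - {j0} \<Longrightarrow> R0 i \<in> C i"
    and far: "\<And>x. x \<in> (\<Inter>i\<in>I - {j0}. R0 i) \<Longrightarrow> t < dist a x"
  obtains j p where "j \<in> I" "p \<in> \<Inter>(C j)" "t < dist a p"
proof -
  define D where "D = (\<lambda>(j, R). \<Inter>i\<in>I - {j}. R i :: 'a set)"
  \<comment> \<open>\<open>PiE\<close> fixes the values outside \<open>I - {j}\<close>, so
    \<open>W\<close> is finite and \<open>m\<close> attains its maximum on it.\<close>
  define W where "W = Sigma I (\<lambda>j. PiE (I - {j}) C)"
  define m where "m w = dist a (closest_point (D w) a)" for w
  have card1: "I - {j} \<noteq> {}" for j
    using card card_mono[of "{j}" I] by auto
  have upd: "(R(j := K)) i \<in> C i" if "i \<in> I" "(j, R) \<in> W" "K \<in> C j" for i j R K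
    using that by (auto simp: W_def PiE_def Pi_def)
  have D: "closed (D w) \<and> convex (D w) \<and> D w \<noteq> {}" if "w \<in> W" for w
  proof -
    obtain j R where w: "w = (j, R)" by force
    have j: "j \<in> I" using that w by (simp add: W_def)
    obtain K where K: "K \<in> C j" using ne j by blast
    have "closed (R i) \<and> convex (R i)" if "i \<in> I - {j}" for i
      using C[of i "R i"] that \<open>w \<in> W\<close> w by (auto simp: W_def PiE_def Pi_def compact_imp_closed)
    then have "closed (D w) \<and> convex (D w)"
      unfolding D_def w by (auto intro!: closed_INT convex_INT)
    moreover have "(\<Inter>i\<in>I. (R(j := K)) i) \<noteq> {}"
      by (rule meet) (use upd K that w in blast)
    then obtain x where x: "\<And>i. i \<in> I \<Longrightarrow> x \<in> (R(j := K)) i" by blast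
    have "x \<in> R i" if "i \<in> I - {j}" for i using x[of i] that by simp
    then have "D w \<noteq> {}" unfolding D_def w by auto
    ultimately show ?thesis by blast
  qed
  have "finite W" unfolding W_def using I fin by (auto intro!: finite_SigmaI finite_PiE)
  let ?w0 = "(j0, restrict R0 (I - {j0}))"
  have w0: "?w0 \<in> W" using j0 by (auto simp: W_def)
  have "t < m ?w0"
    using closest_point_in_set[of "D ?w0" a] D[OF w0] far unfolding m_def by (auto simp: D_def)
  obtain w where w: "w \<in> W" "\<And>w'. w' \<in> W \<Longrightarrow> m w' \<le> m w"
    using Max_in[of "m ` W"] Max_ge[of "m ` W"] \<open>finite W\<close> w0
    by (metis (no_types, lifting) empty_iff finite_imageI image_iff image_is_empty)
  obtain j R where jR: "w = (j, R)" by force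
  define p where "p = closest_point (D w) a"
  have j: "j \<in> I" using w jR by (simp add: W_def)
  have "p \<in> K" if K: "K \<in> C j" for K
  proof -
    \<comment> \<open>Complete the maximal choice by \<open>K\<close>. The distance from
      \<open>a\<close> to \<open>E\<close> persists after dropping some \<open>j'\<close>, so
      maximality bounds it by \<open>m w\<close>. As \<open>E\<close> lies in \<open>D w\<close>,
      its point \<open>q\<close> is then closest in \<open>D w\<close> too, and uniqueness gives
      \<open>q = p\<close>.\<close>
    define F where "F = R(j := K)"
    have F: "F i \<in> C i" if "i \<in> I" for i using upd[of i j R K] that w(1) K jR F_def by blast
    define E where "E = (\<Inter>i\<in>I. F i)"
    have "closed (F i)" if "i \<in> I" for i using F C that compact_imp_closed by blast
    then have "closed E" unfolding E_def by (simp add: closed_INT)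
    moreover have "E \<noteq> {}" unfolding E_def using F by (rule meet)
    ultimately obtain q where q: "q \<in> E" "\<And>x. x \<in> E \<Longrightarrow> dist a q \<le> dist a x"
      using distance_attains_inf by blast
    obtain j' where j': "j' \<in> I" "\<And>x. x \<in> S \<inter> (\<Inter>i\<in>I - {j'}. F i) \<Longrightarrow> dist a q \<le> dist a x"
    proof (rule closest_point_Inter_facet)
      show "I \<noteq> {}" using j by blast
      show "convex (F i) \<and> F i \<subseteq> S" if "i \<in> I" for i using F C that by blast
    qed (use I S q in \<open>auto simp: E_def\<close>)
    let ?w' = "(j', restrict F (I - {j'}))"
    have w': "?w' \<in> W" using j' F by (auto simp: W_def)
    have Dw': "D ?w' = S \<inter> (\<Inter>i\<in>I - {j'}. F i)"
    proof -
      obtain k where k: "k \<in> I - {j'}" using card1[of j'] by blast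
      have "F k \<subseteq> S" using F[of k] C k by blast
      then show ?thesis using k unfolding D_def by auto
    qed
    have "dist a q \<le> m ?w'"
      using j'(2) closest_point_in_set[of "D ?w'" a] D[OF w'] Dw' unfolding m_def by auto
    then have le: "dist a q \<le> m w" using w(2)[OF w'] by simp
    have "q \<in> D w" using q(1) unfolding E_def D_def jR F_def by auto
    moreover have "\<forall>x\<in>D w. dist a q \<le> dist a x"
      using le closest_point_le[of "D w" _ a] D[OF w(1)] unfolding m_def by force
    ultimately have "q = p"
      unfolding p_def using closest_point_unique D[OF w(1)] by blast
    moreover have "q \<in> K" using q(1) j unfolding E_def F_def by force
    ultimately show ?thesis by simp
  qed
  moreover have "t < dist a p" using \<open>t < m ?w0\<close> w(2)[OF w0] unfolding m_def p_def by simp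
  ultimately show ?thesis using that j by blast
qed

text \<open>On a bounded set, the distance from a remote point in direction \<open>- a\<close>
  orders points nearly as \<open>a \<bullet> x\<close> does, so the distance version carries over to
  half-spaces.\<close>

lemma colorful_Helly_halfspace:
  fixes S :: "'a::euclidean_space set" and C :: "'i \<Rightarrow> 'a set set"
  assumes I: "finite I" "aff_dim S + 1 \<le> int (card I)" and card: "2 \<le> card I" and S: "convex S"
    and fin: "\<And>i. i \<in> I \<Longrightarrow> finite (C i)" and ne: "\<And>i. i \<in> I \<Longrightarrow> C i \<noteq> {}"
    and C: "\<And>i K. i \<in> I \<Longrightarrow> K \<in> C i \<Longrightarrow> compact K \<and> convex K \<and> K \<subseteq> S"
    and meet: "\<And>R. (\<And>i. i \<in> I \<Longrightarrow> R i \<in> C i) \<Longrightarrow> (\<Inter>i\<in>I. R i) \<noteq> {}"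
    and j0: "j0 \<in> I" "\<And>i. i \<in> I - {j0} \<Longrightarrow> R0 i \<in> C i"
    and side: "\<And>x. x \<in> (\<Inter>i\<in>I - {j0}. R0 i) \<Longrightarrow> b < a \<bullet> x"
  obtains j p where "j \<in> I" "p \<in> \<Inter>(C j)" "b < a \<bullet> p"
proof -
  define Q where "Q = (\<Inter>i\<in>I - {j0}. R0 i)"
  obtain i1 where i1: "i1 \<in> I - {j0}"
    using card card_mono[of "{j0}" I] by fastforce
  have "compact Q"
    unfolding Q_def using i1 C j0(2) by (intro compact_Inter) auto
  \<comment> \<open>Compactness turns the strict inequality into a uniform gap.\<close>
  obtain e where e: "e > 0" "\<And>x. x \<in> Q \<Longrightarrow> b + e \<le> a \<bullet> x"
  proof (cases "Q = {}")
    case True then show ?thesis using that[of 1] by simp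
  next
    case False
    then obtain y where y: "y \<in> Q" "\<forall>x\<in>Q. a \<bullet> y \<le> a \<bullet> x"
      using continuous_attains_inf[OF \<open>compact Q\<close> False continuous_on_inner[OF continuous_on_const continuous_on_id]]
      by blast
    then show ?thesis using that[of "a \<bullet> y - b"] side unfolding Q_def by force
  qed
  have "bounded (\<Union>i\<in>I. \<Union>(C i))"
    using I(1) fin C by (intro bounded_UN ballI bounded_Union) (auto intro: compact_imp_bounded)
  then obtain r where r: "r > 0" "\<And>i K x. i \<in> I \<Longrightarrow> K \<in> C i \<Longrightarrow> x \<in> K \<Longrightarrow> norm x \<le> r"
    unfolding bounded_pos by blast
  define M where "M = r\<^sup>2 / e"
  have M: "M > 0" "2 * M * e > r\<^sup>2" using e(1) r(1) by (auto simp: M_def)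
  \<comment> \<open>Seen from the remote point \<open>z\<close>, a ball of radius \<open>r\<close> is too small to make points with
    \<open>a \<bullet> x \<le> b\<close> as distant as points with \<open>a \<bullet> x \<ge> b + e\<close>.\<close>
  define z where "z = - M *\<^sub>R a"
  have dist: "(dist z x)\<^sup>2 = (norm x)\<^sup>2 + 2 * M * (a \<bullet> x) + (norm z)\<^sup>2" for x
    unfolding z_def dist_norm power2_norm_eq_inner
    by (simp add: inner_diff_left inner_diff_right inner_commute algebra_simps)
  \<comment> \<open>The radicand bounds the squared distance from \<open>z\<close> for points of
    norm at most \<open>r\<close> with \<open>a \<bullet> x \<le> b\<close>; points beyond the gap
    exceed it because \<open>2 * M * e > r^2\<close>.\<close>
  define t where "t = sqrt (r\<^sup>2 + 2 * M * b + (norm z)\<^sup>2)"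
  obtain j p where jp: "j \<in> I" "p \<in> \<Inter>(C j)" "t < dist z p"
  proof (rule colorful_Helly_dist[OF I card S fin ne C meet j0])
    fix x assume "x \<in> (\<Inter>i\<in>I - {j0}. R0 i)"
    then have "b + e \<le> a \<bullet> x" using e(2) Q_def by blast
    then have "2 * M * b + 2 * M * e \<le> 2 * M * (a \<bullet> x)"
      using M(1) mult_left_mono[of "b + e" "a \<bullet> x" "2 * M"] by (simp add: algebra_simps)
    then have "r\<^sup>2 + 2 * M * b + (norm z)\<^sup>2 < (dist z x)\<^sup>2"
      unfolding dist using M(2) zero_le_power2[of "norm x"] by linarith
    then show "t < dist z x"
      unfolding t_def by (rule real_less_lsqrt[rotated -1]) auto
  qed auto
  have "b < a \<bullet> p"
  proof (rule ccontr)
    assume "\<not> b < a \<bullet> p"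
    then have "2 * M * (a \<bullet> p) \<le> 2 * M * b" using M(1) by simp
    moreover have "(norm p)\<^sup>2 \<le> r\<^sup>2" using r jp ne by (metis InterE all_not_in_conv norm_ge_zero power_mono)
    ultimately have "(dist z p)\<^sup>2 \<le> r\<^sup>2 + 2 * M * b + (norm z)\<^sup>2" unfolding dist by linarith
    then have "dist z p \<le> t" unfolding t_def by (rule real_le_rsqrt)
    then show False using jp by simp
  qed
  then show ?thesis using that jp by blast
qed

section \<open>Dimensions of unions, and hyperplanes\<close>

text \<open>An affine basis of \<open>T\<close> has \<open>aff_dim T + 1\<close> points, and each
  adds at most one to the dimension.\<close>

lemma aff_dim_Un_le:
  fixes S T :: "'a::euclidean_space set"
  shows "aff_dim (S \<union> T) \<le> aff_dim S + aff_dim T + 1"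
proof -
  obtain B where B: "\<not> affine_dependent B" "affine hull B = affine hull T"
    using affine_basis_exists by blast
  have "finite B" using B aff_independent_finite by blast
  then have "aff_dim (S \<union> B) \<le> aff_dim S + int (card B)"
  proof induction
    case (insert x B)
    then show ?case using aff_dim_insert[of x "S \<union> B"] by (simp split: if_splits)
  qed simp
  moreover have "aff_dim T = int (card B) - 1"
    using B aff_dim_affine_hull2[of B T] aff_dim_affine_independent[of B] by simp
  moreover have "S \<union> T \<subseteq> affine hull (S \<union> B)"
    using hull_mono[of B "S \<union> B" affine] hull_subset[of T affine] hull_subset[of "S \<union> B" affine]
    unfolding B(2) by blast
  then have "aff_dim (S \<union> T) \<le> aff_dim (S \<union> B)"
    using aff_dim_subset[of "S \<union> T" "affine hull (S \<union> B)"] by simp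
  ultimately show ?thesis by simp
qed

lemma aff_dim_UN_le:
  fixes K :: "'i \<Rightarrow> 'a::euclidean_space set"
  assumes "finite I"
  shows "aff_dim (\<Union>i\<in>I. K i) + 1 \<le> (\<Sum>i\<in>I. aff_dim (K i) + 1)"
  using assms
proof induction
  case (insert i I)
  then show ?case using aff_dim_Un_le[of "K i" "\<Union>i\<in>I. K i"] by simp
qed simp

text \<open>An affine hull is an intersection of hyperplanes, and by dimension one of them does not
  contain \<open>S\<close>. An empty \<open>U\<close> is replaced by a point of \<open>S\<close> so
  that the hyperplane meets \<open>S\<close>.\<close>

lemma hyperplane_separating_from_affine:
  fixes S U :: "'a::euclidean_space set"
  assumes "U \<subseteq> S" and lt: "aff_dim U < aff_dim S" and pos: "aff_dim S > 0"
  obtains a b where "U \<subseteq> {x. a \<bullet> x = b}" "S \<inter> {x. a \<bullet> x = b} \<noteq> {}" "\<not> S \<subseteq> {x. a \<bullet> x = b}"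
proof -
  obtain s where "s \<in> S" using pos by (cases "S = {}") auto
  define U' where "U' = (if U = {} then {s} else U)"
  have U': "U \<subseteq> U'" "U' \<noteq> {}" "U' \<subseteq> S" "aff_dim U' < aff_dim S"
    using assms \<open>s \<in> S\<close> by (auto simp: U'_def)
  obtain \<F> where \<F>: "affine hull U' = \<Inter>\<F>" "\<And>h. h \<in> \<F> \<Longrightarrow> \<exists>a b. a \<noteq> 0 \<and> h = {x. a \<bullet> x = b}"
    using affine_hull_finite_intersection_hyperplanes[of U'] by metis
  have "\<not> S \<subseteq> affine hull U'"
    using U'(4) aff_dim_subset[of S "affine hull U'"] by auto
  then obtain h where h: "h \<in> \<F>" "\<not> S \<subseteq> h" using \<F> by auto
  have "U' \<subseteq> h" using h \<F> hull_subset[of U' affine] by auto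
  then show ?thesis using \<F>(2)[OF h(1)] h(2) U' that by blast
qed

section \<open>The dimension inequality\<close>

text \<open>The ambient space is any affine \<open>S\<close>, so that the induction can pass to
  \<open>S \<inter> H\<close> within one type.\<close>

lemma colorful_Helly_aff_dim_compact:
  fixes S :: "'a::euclidean_space set" and C :: "'i \<Rightarrow> 'a set set"
  assumes "finite I" "card I = d + 1" "affine S" "aff_dim S = int d"
    and "\<And>i. i \<in> I \<Longrightarrow> finite (C i)" "\<And>i. i \<in> I \<Longrightarrow> C i \<noteq> {}"
    and "\<And>i K. i \<in> I \<Longrightarrow> K \<in> C i \<Longrightarrow> compact K \<and> convex K \<and> K \<subseteq> S"
    and "\<And>R. (\<And>i. i \<in> I \<Longrightarrow> R i \<in> C i) \<Longrightarrow> (\<Inter>i\<in>I. R i) \<noteq> {}"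
  shows "(\<Sum>i\<in>I. aff_dim (\<Inter>(C i))) \<ge> 0"
  using assms
proof (induction d arbitrary: I S C)
  case 0
  obtain i where i: "I = {i}" using "0.prems"(2) by (auto simp: card_1_singleton_iff)
  obtain s where s: "S = {s}" using "0.prems"(4) by (auto simp: aff_dim_eq_0)
  have "K = {s}" if "K \<in> C i" for K
    using "0.prems"(7)[of i K] "0.prems"(8)[of "\<lambda>_. K"] that i s by auto
  then have "\<Inter>(C i) = {s}" using "0.prems"(6)[of i] i by auto
  then show ?case using i by simp
next
  case (Suc d)
  note fin = Suc.prems(5) and ne = Suc.prems(6) and C = Suc.prems(7) and meet = Suc.prems(8)
  show ?case
  proof (rule ccontr)
    assume "\<not> ?case"
    then have neg: "(\<Sum>i\<in>I. aff_dim (\<Inter>(C i))) < 0" by simp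
    let ?U = "\<Union>i\<in>I. \<Inter>(C i)"
    have "?U \<subseteq> S" using C ne by blast
    \<comment> \<open>Here \<open>card I = d + 2\<close>, so a sum of at most -1 leaves
      \<open>aff_dim ?U \<le> d\<close>.\<close>
    moreover have "aff_dim ?U < aff_dim S"
      using aff_dim_UN_le[OF Suc.prems(1), of "\<lambda>i. \<Inter>(C i)"] neg Suc.prems(2,4)
      by (simp add: sum.distrib)
    ultimately obtain a b where H: "?U \<subseteq> {x. a \<bullet> x = b}" "S \<inter> {x. a \<bullet> x = b} \<noteq> {}"
        "\<not> S \<subseteq> {x. a \<bullet> x = b}"
      by (rule hyperplane_separating_from_affine) (use Suc.prems(4) in auto)
    define H where "H = {x. a \<bullet> x = b}"
    have dimSH: "aff_dim (S \<inter> H) = int d"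
      unfolding H_def aff_dim_affine_Int_hyperplane[OF Suc.prems(3)] using H Suc.prems(4) by simp
    \<comment> \<open>Drop a nonempty intersection if there is one; otherwise every summand is -1
      and at least one remains after dropping any index.\<close>
    obtain j where j: "j \<in> I" "(\<Sum>i\<in>I - {j}. aff_dim (\<Inter>(C i))) < 0"
    proof (cases "\<exists>j\<in>I. aff_dim (\<Inter>(C j)) \<ge> 0")
      case True
      then obtain j where "j \<in> I" "aff_dim (\<Inter>(C j)) \<ge> 0" by blast
      then show ?thesis using that[of j] neg Suc.prems(1) by (simp add: sum_diff1)
    next
      case False
      obtain j where "j \<in> I" using Suc.prems(2) by fastforce
      have "(\<Sum>i\<in>I - {j}. aff_dim (\<Inter>(C i))) < (\<Sum>i\<in>I - {j}. 0)"
      proof (rule sum_strict_mono)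
        show "I - {j} \<noteq> {}" using Suc.prems(2) card_mono[of "{j}" I] by auto
      qed (use False Suc.prems(1) in \<open>simp_all add: not_le del: aff_dim_negative_iff\<close>)
      then show ?thesis using that[of j] \<open>j \<in> I\<close> by simp
    qed
    \<comment> \<open>Otherwise the induction hypothesis would apply to the traces on
      \<open>H\<close>, whose intersections are the old ones because these already lie in
      \<open>H\<close>.\<close>
    have "\<not> (\<forall>R. (\<forall>i\<in>I - {j}. R i \<in> (\<lambda>K. K \<inter> H) ` C i) \<longrightarrow> (\<Inter>i\<in>I - {j}. R i) \<noteq> {})"
    proof
      assume *: "\<forall>R. (\<forall>i\<in>I - {j}. R i \<in> (\<lambda>K. K \<inter> H) ` C i) \<longrightarrow> (\<Inter>i\<in>I - {j}. R i) \<noteq> {}"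
      have "(\<Sum>i\<in>I - {j}. aff_dim (\<Inter>((\<lambda>K. K \<inter> H) ` C i))) \<ge> 0"
      proof (rule Suc.IH)
        show "finite (I - {j})" "card (I - {j}) = d + 1" using Suc.prems(1,2) j by auto
        show "affine (S \<inter> H)" unfolding H_def using Suc.prems(3) affine_hyperplane
          by (intro affine_Int) auto
        show "aff_dim (S \<inter> H) = int d" by (rule dimSH)
        show "compact K \<and> convex K \<and> K \<subseteq> S \<inter> H"
          if "i \<in> I - {j}" "K \<in> (\<lambda>K. K \<inter> H) ` C i" for i K
          using that C unfolding H_def
          by (auto intro!: compact_Int_closed convex_Int closed_hyperplane convex_hyperplane)
      qed (use fin ne * in auto)
      moreover have "\<Inter>((\<lambda>K. K \<inter> H) ` C i) = \<Inter>(C i)" if "i \<in> I - {j}" for i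
        using that ne[of i] H(1) unfolding H_def by auto
      ultimately show False using j(2) by simp
    qed
    then obtain R' where R': "\<And>i. i \<in> I - {j} \<Longrightarrow> R' i \<in> (\<lambda>K. K \<inter> H) ` C i"
        "(\<Inter>i\<in>I - {j}. R' i) = {}" by blast
    then have "\<exists>R. \<forall>i\<in>I - {j}. R i \<in> C i \<and> R' i = R i \<inter> H"
      by (intro bchoice) blast
    then obtain R where R: "\<And>i. i \<in> I - {j} \<Longrightarrow> R i \<in> C i"
        "\<And>i. i \<in> I - {j} \<Longrightarrow> R' i = R i \<inter> H" by blast
    define Q where "Q = (\<Inter>i\<in>I - {j}. R i)"
    have "x \<in> (\<Inter>i\<in>I - {j}. R' i)" if "x \<in> Q" "x \<in> H" for x
      using that R(2) unfolding Q_def by blast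
    then have "Q \<inter> H = {}" using R'(2) by blast
    moreover have "convex Q" unfolding Q_def
    proof (rule convex_INT)
      show "convex (R i)" if "i \<in> I - {j}" for i
        using C[of i "R i"] R(1)[OF that] that by blast
    qed
    ultimately have "\<not> (x \<in> Q \<and> y \<in> Q \<and> a \<bullet> x \<le> b \<and> b \<le> a \<bullet> y)" for x y
      using connected_ivt_hyperplane[of Q x y a b] convex_connected[of Q] unfolding H_def by blast
    then have "(\<forall>x\<in>Q. b < a \<bullet> x) \<or> (\<forall>x\<in>Q. a \<bullet> x < b)"
      by (meson not_le)
    \<comment> \<open>Flipping the signs of \<open>a\<close> and \<open>b\<close> if necessary puts
      \<open>Q\<close> on the positive side.\<close>
    then obtain c b' where cb: "\<And>x. x \<in> Q \<Longrightarrow> b' < c \<bullet> x" "H \<subseteq> {x. c \<bullet> x = b'}"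
    proof
      assume "\<forall>x\<in>Q. a \<bullet> x < b"
      then show ?thesis using that[of "- b" "- a"] unfolding H_def by auto
    qed (use that[of b a] in \<open>auto simp: H_def\<close>)
    obtain i p where "i \<in> I" "p \<in> \<Inter>(C i)" "b' < c \<bullet> p"
    proof (rule colorful_Helly_halfspace[OF Suc.prems(1) _ _ _ fin ne C meet j(1) R(1)])
      show "aff_dim S + 1 \<le> int (card I)" "2 \<le> card I" "convex S"
        using Suc.prems(2-4) by (auto simp: affine_imp_convex)
    qed (use cb(1) Q_def in auto)
    then show False using H(1) cb(2) unfolding H_def by fastforce
  qed
qed

text \<open>\<open>P i K\<close> is the hull of the points picked for those rainbow choices that use
  \<open>K\<close> at \<open>i\<close>. It is compact and inside \<open>K\<close>, so dimensions can
  only drop, while the point picked for a choice stays common to the corresponding hulls.\<close>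

lemma colorful_Helly_aff_dim:
  fixes S :: "'a::euclidean_space set" and C :: "'i \<Rightarrow> 'a set set"
  assumes I: "finite I" "card I = d + 1" and S: "affine S" "aff_dim S = int d"
    and fin: "\<And>i. i \<in> I \<Longrightarrow> finite (C i)" and ne: "\<And>i. i \<in> I \<Longrightarrow> C i \<noteq> {}"
    and C: "\<And>i K. i \<in> I \<Longrightarrow> K \<in> C i \<Longrightarrow> convex K \<and> K \<subseteq> S"
    and meet: "\<And>R. (\<And>i. i \<in> I \<Longrightarrow> R i \<in> C i) \<Longrightarrow> (\<Inter>i\<in>I. R i) \<noteq> {}"
  shows "(\<Sum>i\<in>I. aff_dim (\<Inter>(C i))) \<ge> 0"
proof -
  let ?W = "PiE I C"
  have "\<exists>p. \<forall>R\<in>?W. p R \<in> (\<Inter>i\<in>I. R i)"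
  proof (intro bchoice ballI)
    fix R assume "R \<in> ?W"
    then have "(\<Inter>i\<in>I. R i) \<noteq> {}" by (intro meet) (rule PiE_mem)
    then show "\<exists>x. x \<in> (\<Inter>i\<in>I. R i)" by blast
  qed
  then obtain p where *: "\<forall>R\<in>?W. p R \<in> (\<Inter>i\<in>I. R i)" ..
  have p: "p R \<in> R i" if "R \<in> ?W" "i \<in> I" for R i
    using bspec[OF * that(1)] that(2) by (rule INT_D)
  have "finite ?W" using I(1) fin by (intro finite_PiE) auto
  define P where "P i K = convex hull (p ` {R \<in> ?W. R i = K})" for i K
  have P: "P i K \<subseteq> K" if "i \<in> I" "K \<in> C i" for i K
    unfolding P_def
  proof (rule hull_minimal)
    show "p ` {R \<in> ?W. R i = K} \<subseteq> K" using p[OF _ that(1)] by blast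
    show "convex K" using C[OF that] by blast
  qed
  have "(\<Sum>i\<in>I. aff_dim (\<Inter>(P i ` C i))) \<ge> 0"
  proof (rule colorful_Helly_aff_dim_compact)
    show "affine S" by (rule S(1))
    show "aff_dim S = int d" by (rule S(2))
    show "compact K \<and> convex K \<and> K \<subseteq> S" if i: "i \<in> I" and K: "K \<in> P i ` C i" for i K
    proof -
      obtain L where L: "L \<in> C i" "K = P i L" using K by blast
      then show ?thesis
        using P[OF i L(1)] C[OF i L(1)] \<open>finite ?W\<close> unfolding P_def
        by (auto intro!: finite_imp_compact_convex_hull)
    qed
    show "(\<Inter>i\<in>I. R i) \<noteq> {}" if "\<And>i. i \<in> I \<Longrightarrow> R i \<in> P i ` C i" for R
    proof -
      have "\<exists>L. \<forall>i\<in>I. L i \<in> C i \<and> R i = P i (L i)"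
        using that by (intro bchoice) blast
      then obtain L where L: "\<And>i. i \<in> I \<Longrightarrow> L i \<in> C i" "\<And>i. i \<in> I \<Longrightarrow> R i = P i (L i)" by blast
      have "p (restrict L I) \<in> R i" if "i \<in> I" for i
        using L that unfolding L(2)[OF that] P_def by (intro hull_inc imageI) auto
      then show ?thesis by blast
    qed
  qed (use I fin ne in auto)
  also have "\<dots> \<le> (\<Sum>i\<in>I. aff_dim (\<Inter>(C i)))"
    using P by (intro sum_mono aff_dim_subset) fast
  finally show ?thesis .
qed

text \<open>A Euclidean type has positive dimension; a \<open>d\<close>-dimensional subspace
  \<open>V\<close> in the role of R^d also covers \<open>d = 0\<close>.\<close>

theorem theorem1p5:
  fixes d :: nat
    and V :: "'a::euclidean_space set"
    and C :: "nat \<Rightarrow> 'a set set"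
  assumes "subspace V" and "dim V = d"
    and "\<And>i. i \<in> {1..d+1} \<Longrightarrow> finite (C i)"
    and "\<And>i. i \<in> {1..d+1} \<Longrightarrow> C i \<noteq> {}"
    and "\<And>i K. i \<in> {1..d+1} \<Longrightarrow> K \<in> C i \<Longrightarrow> convex K \<and> K \<subseteq> V"
    and "\<And>K. (\<And>i. i \<in> {1..d+1} \<Longrightarrow> K i \<in> C i) \<Longrightarrow> (\<Inter>i\<in>{1..d+1}. K i) \<noteq> {}"
  shows "(\<Sum>i=1..d+1. aff_dim (\<Inter>(C i))) \<ge> 0"
proof (rule colorful_Helly_aff_dim)
  show "affine V" using assms(1) by (rule subspace_imp_affine)
  show "aff_dim V = int d" using assms(1,2) by (simp add: aff_dim_subspace)
qed (use assms in simp_all)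

end
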